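(* Let $f \in (0,1)$ and $a, b \in \mathbb{R}$ be such that $$0 \le a, \qquad 0 \le b \le f, \qquad 3f + 4a - b - 1 \le 0 .$$ Let $$v = \frac{f^2 + fa - 3fb - 3ab + b}{f^2 + f - 3bf}.$$ Consider the function $\pi\colon \mathbb{R}/\mathbb{Z} \to \mathbb{R}$ (regarded as a $1$-periodic function $\mathbb{R}\to\mathbb{R}$) that on $[0,1]$ is the continuous piecewise linear function with breakpoints $$0,\quad f,\quad f+a,\quad \frac{1+f-b}{2},\quad \frac{1+f+b}{2},\quad 1-a,\quad 1,$$ linear between consecutive breakpoints, with values at the breakpoints $$\pi(0)=\pi(1)=0,\quad \pi(f)=1,\quad \pi(f+a)=v,\quad \pi(1-a)=1-v,$$ $$\pi\Big(\frac{1+f-b}{2}\Big)=\frac{f-b}{2f},\quad \pi\Big(\frac{1+f+b}{2}\Big)=1-\frac{f-b}{2f}=\frac{f+b}{2f}.$$ Assume that these data define a function, i.e., that the denominator $f^2+f-3bf$ is nonzero and that whenever two of the listed breakpoints coincide, the values prescribed at them agree. Then $\pi$ is an extreme function for $R_f(\mathbb{R},\mathbb{Z})$.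
   Context: Fix $f\in\mathbb{R}\setminus\mathbb{Z}$. The (single-row) infinite group problem considers all functions $y\colon\mathbb{R}\to\mathbb{Z}_+$ of finite support (where $\mathbb{Z}_+$ denotes the nonnegative integers) satisfying $\sum_{r\in\mathbb{R}} r\,y(r)\equiv f \pmod 1$, i.e., $\sum_r r\,y(r) - f\in\mathbb{Z}$. $R_f(\mathbb{R},\mathbb{Z})$ denotes the convex hull of the set of all such functions $y$. A valid function for $R_f(\mathbb{R},\mathbb{Z})$ is a nonnegative function $\pi\colon\mathbb{R}\to\mathbb{R}$ such that $\sum_{r\in\mathbb{R}}\pi(r)\,y(r)\ge 1$ for every $y\in R_f(\mathbb{R},\mathbb{Z})$. A valid function $\pi$ is extreme if it is not a proper convex combination of other valid functions; that is, whenever $\pi=\tfrac12(\pi_1+\pi_2)$ with $\pi_1,\pi_2$ valid functions, then $\pi_1=\pi_2=\pi$. A function on $\mathbb{R}/\mathbb{Z}$ is identified with a $1$-periodic function on $\mathbb{R}$. *)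

theory Defs
  imports
    "HOL-Analysis.Analysis"
    "HOL-Analysis.Finite_Function_Topology"
begin

text \<open>
  Functions of finite support on the reals are elements of \<open>real \<Rightarrow>\<^sub>0 real\<close>, which is a real vector
  space, so that the library's \<open>convex hull\<close> applies. All sums over the reals below are sums over
  the finite support \<open>keys y\<close>.
\<close>

definition group_solutions :: "real \<Rightarrow> (real \<Rightarrow>\<^sub>0 real) set" where
  "group_solutions f =
     {y. (\<forall>r. Poly_Mapping.lookup y r \<in> \<nat>) \<and>
         (\<Sum>r\<in>Poly_Mapping.keys y. r * Poly_Mapping.lookup y r) - f \<in> \<int>}"

definition infinite_group_problem :: "real \<Rightarrow> (real \<Rightarrow>\<^sub>0 real) set" where
  "infinite_group_problem f = convex hull (group_solutions f)"

definition valid_function :: "real \<Rightarrow> (real \<Rightarrow> real) \<Rightarrow> bool" where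
  "valid_function f \<pi> \<longleftrightarrow>
     (\<forall>r. 0 \<le> \<pi> r) \<and>
     (\<forall>y\<in>infinite_group_problem f.
        1 \<le> (\<Sum>r\<in>Poly_Mapping.keys y. \<pi> r * Poly_Mapping.lookup y r))"

definition extreme_function :: "real \<Rightarrow> (real \<Rightarrow> real) \<Rightarrow> bool" where
  "extreme_function f \<pi> \<longleftrightarrow>
     valid_function f \<pi> \<and>
     (\<forall>\<pi>\<^sub>1 \<pi>\<^sub>2. valid_function f \<pi>\<^sub>1 \<longrightarrow> valid_function f \<pi>\<^sub>2 \<longrightarrow>
        (\<forall>x. \<pi> x = 1/2 * (\<pi>\<^sub>1 x + \<pi>\<^sub>2 x)) \<longrightarrow> \<pi>\<^sub>1 = \<pi> \<and> \<pi>\<^sub>2 = \<pi>)"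

text \<open>
  Interpolation data is a list of pairs (breakpoint, value), the breakpoints in weakly increasing
  order. Breakpoints may coincide; the data then define a function only if the values agree.
\<close>

definition consistent_data :: "(real \<times> real) list \<Rightarrow> bool" where
  "consistent_data ps \<longleftrightarrow>
     (\<forall>p\<in>set ps. \<forall>q\<in>set ps. fst p = fst q \<longrightarrow> snd p = snd q)"

definition pwl_interpolant :: "(real \<times> real) list \<Rightarrow> (real \<Rightarrow> real) \<Rightarrow> bool" where
  "pwl_interpolant ps \<pi> \<longleftrightarrow>
     continuous_on {fst (hd ps)..fst (last ps)} \<pi> \<and>
     (\<forall>p\<in>set ps. \<pi> (fst p) = snd p) \<and>
     (\<forall>i. Suc i < length ps \<longrightarrow>
        (\<exists>c d. \<forall>x\<in>{fst (ps ! i)..fst (ps ! Suc i)}. \<pi> x = c * x + d))"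

text \<open>
  The parameter \<open>v\<close> is the value at \<open>f + a\<close>. For \<open>0 < f < 1\<close>, \<open>0 \<le> a\<close>, \<open>0 \<le> b \<le> f\<close> and
  \<open>3 * f + 4 * a - b - 1 \<le> 0\<close> the breakpoints are weakly increasing from \<open>0\<close> to \<open>1\<close>.
\<close>

definition breakpoint_data :: "real \<Rightarrow> real \<Rightarrow> real \<Rightarrow> real \<Rightarrow> (real \<times> real) list" where
  "breakpoint_data f a b v =
     [(0, 0),
      (f, 1),
      (f + a, v),
      ((1 + f - b) / 2, (f - b) / (2 * f)),
      ((1 + f + b) / 2, 1 - (f - b) / (2 * f)),
      (1 - a, 1 - v),
      (1, 0)]"

end

(*
  If \<pi> = (g + h)/2 with g, h valid, then validity at x + y \<equiv> f and x + y + z \<equiv> f forces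
  g to be periodic, symmetric, subadditive, continuous, and additive wherever \<pi> is.

  Subadditivity of \<pi> is the inequality \<pi>(p) + \<pi>(q) + \<pi>(r) \<ge> 1 for p + q + r = f. As \<pi>
  is concave between consecutive convex breakpoints 0, f + a, C = (1 + f - b)/2, two of the
  arguments can be slid to such breakpoints, where only the pairs (f + a, f + a), (f + a, C)
  and (C, C) matter. The last two are equalities; this is what determines v.

  Additivity of \<pi> on full-dimensional regions makes g affine on [0, f], [-a, 0] and [f + a, C]
  (interval lemma); the additivity at (C, C) and (f + a, C) then fixes the slopes of g.
*)
theory Submission
  imports Defs
begin

subsection \<open>Valid functions\<close>

definition cost :: "(real \<Rightarrow> real) \<Rightarrow> (real \<Rightarrow>\<^sub>0 real) \<Rightarrow> real" where
  "cost g y = (\<Sum>r\<in>Poly_Mapping.keys y. g r * Poly_Mapping.lookup y r)"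

lemma cost_superset:
  assumes "finite S" "Poly_Mapping.keys y \<subseteq> S"
  shows "cost g y = (\<Sum>r\<in>S. g r * Poly_Mapping.lookup y r)"
  unfolding cost_def using assms by (intro sum.mono_neutral_left) (auto simp: in_keys_iff)

lemma cost_add: "cost g (y + z) = cost g y + cost g z"
proof -
  let ?S = "Poly_Mapping.keys y \<union> Poly_Mapping.keys z"
  have "cost g (y + z) = (\<Sum>r\<in>?S. g r * Poly_Mapping.lookup (y + z) r)"
    by (intro cost_superset) (auto dest: subsetD[OF Poly_Mapping.keys_add])
  also have "\<dots> = (\<Sum>r\<in>?S. g r * Poly_Mapping.lookup y r) + (\<Sum>r\<in>?S. g r * Poly_Mapping.lookup z r)"
    by (simp add: lookup_add distrib_left sum.distrib)
  also have "\<dots> = cost g y + cost g z"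
    by (simp add: cost_superset[where S = ?S])
  finally show ?thesis .
qed

lemma lookup_scaleR: "Poly_Mapping.lookup (c *\<^sub>R y) r = c *\<^sub>R Poly_Mapping.lookup y r"
  unfolding scaleR_poly_mapping_def
  by (subst Abs_poly_mapping_inverse) (auto intro: finite_subset[OF _ finite_lookup[of y]])

lemma cost_scaleR: "cost g (c *\<^sub>R y) = c * cost g y"
proof -
  have "cost g (c *\<^sub>R y) = (\<Sum>r\<in>Poly_Mapping.keys y. g r * Poly_Mapping.lookup (c *\<^sub>R y) r)"
    by (intro cost_superset) (auto simp: in_keys_iff lookup_scaleR)
  also have "\<dots> = c * cost g y"
    by (simp add: cost_def lookup_scaleR sum_distrib_left algebra_simps)
  finally show ?thesis .
qed

lemma cost_single: "cost g (Poly_Mapping.single x c) = g x * c"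
  by (simp add: cost_superset[where S = "{x}"])

text \<open>Since \<open>cost g\<close> is linear, \<open>1 \<le> cost g y\<close> cuts out a convex
  set of \<open>y\<close>, so the inequality passes from the group solutions to their convex
  hull.\<close>

lemma valid_function_iff:
  "valid_function f g \<longleftrightarrow>
     (\<forall>r. 0 \<le> g r) \<and> (\<forall>y\<in>group_solutions f. 1 \<le> cost g y)"
proof -
  have "convex {y. 1 \<le> cost g y}"
    unfolding convex_def
  proof clarsimp
    fix y z and u v :: real
    assume *: "1 \<le> cost g y" "1 \<le> cost g z" "0 \<le> u" "0 \<le> v" "u + v = 1"
    have "u * 1 + v * 1 \<le> u * cost g y + v * cost g z"
      using * by (intro add_mono mult_left_mono)
    with * show "1 \<le> cost g (u *\<^sub>R y + v *\<^sub>R z)"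
      by (simp add: cost_add cost_scaleR)
  qed
  then have "(\<forall>y\<in>group_solutions f. 1 \<le> cost g y) \<longleftrightarrow> (\<forall>y\<in>infinite_group_problem f. 1 \<le> cost g y)"
    unfolding infinite_group_problem_def
    using hull_minimal[of "group_solutions f" "{y. 1 \<le> cost g y}" convex]
      hull_subset[of "group_solutions f" convex] by blast
  then show ?thesis
    unfolding valid_function_def cost_def by blast
qed

lemma valid_function_triple:
  assumes "valid_function f g" "x + y + z - f \<in> \<int>"
  shows "1 \<le> g x + g y + g z"
proof -
  \<comment> \<open>Adding singletons keeps the multiplicities right when some of the points
    coincide.\<close>
  let ?p = "Poly_Mapping.single x 1 + Poly_Mapping.single y 1 + Poly_Mapping.single z (1::real)"
  have "Poly_Mapping.lookup ?p r \<in> \<nat>" for r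
    by (auto simp: lookup_add lookup_single when_def intro!: Nats_add)
  moreover have "cost (\<lambda>r. r) ?p = x + y + z"
    by (simp add: cost_add cost_single)
  ultimately have "?p \<in> group_solutions f"
    using assms(2) by (simp add: group_solutions_def cost_def)
  then have "1 \<le> cost g ?p"
    using assms(1) by (simp only: valid_function_iff)
  then show ?thesis by (simp add: cost_add cost_single)
qed

lemma valid_function_pair:
  assumes "valid_function f g" "x + y - f \<in> \<int>"
  shows "1 \<le> g x + g y"
proof -
  let ?p = "Poly_Mapping.single x 1 + Poly_Mapping.single y (1::real)"
  have "Poly_Mapping.lookup ?p r \<in> \<nat>" for r
    by (auto simp: lookup_add lookup_single when_def intro!: Nats_add)
  moreover have "cost (\<lambda>r. r) ?p = x + y"
    by (simp add: cost_add cost_single)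
  ultimately have "?p \<in> group_solutions f"
    using assms(2) by (simp add: group_solutions_def cost_def)
  then have "1 \<le> cost g ?p"
    using assms(1) by (simp only: valid_function_iff)
  then show ?thesis by (simp add: cost_add cost_single)
qed

lemma periodic_Ints:
  fixes g :: "real \<Rightarrow> 'a"
  assumes "\<And>x. g (x + 1) = g x" "x - y \<in> \<int>"
  shows "g x = g y"
proof -
  have nat: "g (z + of_nat n) = g z" for z n
  proof (induction n)
    case (Suc n)
    have "g (z + of_nat (Suc n)) = g ((z + of_nat n) + 1)" by (simp add: algebra_simps)
    then show ?case using Suc assms(1) by simp
  qed simp
  obtain k where k: "x - y = of_int k" using assms(2) by (auto elim: Ints_cases)
  show ?thesis
  proof (cases k rule: int_cases2)
    case (nonneg n)
    then show ?thesis using k nat[of y n] by (simp add: algebra_simps)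
  next
    case (nonpos n)
    then have "y = x + of_nat n" using k by simp
    then show ?thesis using nat[of x n] by simp
  qed
qed

text \<open>Subadditivity bounds the cost of a solution from below by the value of \<open>g\<close>
  at the total of its entries; that total is congruent to \<open>f\<close>, so periodicity makes the
  value \<open>g f = 1\<close>.\<close>

lemma valid_function_if_subadditive:
  assumes nonneg: "\<And>x. 0 \<le> g x" and periodic: "\<And>x. g (x + 1) = g x"
    and subadd: "\<And>x y. g (x + y) \<le> g x + g y"
    and zero: "g 0 = 0" and f: "g f = 1"
  shows "valid_function f g"
  unfolding valid_function_iff
proof (intro conjI allI ballI)
  fix y assume y: "y \<in> group_solutions f"
  have mult: "g (r * of_nat n) \<le> g r * of_nat n" for r n
  proof (induction n)
    case (Suc n)
    have "g (r * of_nat (Suc n)) \<le> g r + g (r * of_nat n)"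
      using subadd[of r "r * of_nat n"] by (simp add: algebra_simps)
    then show ?case using Suc by (simp add: algebra_simps)
  qed (simp add: zero)
  have mult': "g (r * Poly_Mapping.lookup y r) \<le> g r * Poly_Mapping.lookup y r" for r
  proof -
    have "Poly_Mapping.lookup y r \<in> \<nat>" using y by (simp add: group_solutions_def)
    then show ?thesis using mult by (auto elim: Nats_cases)
  qed
  have "finite S \<Longrightarrow> g (\<Sum>r\<in>S. r * Poly_Mapping.lookup y r)
          \<le> (\<Sum>r\<in>S. g r * Poly_Mapping.lookup y r)" for S
  proof (induction S rule: finite_induct)
    case (insert r S)
    then show ?case
      using subadd[of "r * Poly_Mapping.lookup y r" "\<Sum>r\<in>S. r * Poly_Mapping.lookup y r"] mult'[of r]
      by simp
  qed (simp add: zero)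
  then have "g (\<Sum>r\<in>Poly_Mapping.keys y. r * Poly_Mapping.lookup y r) \<le> cost g y"
    by (simp add: cost_def)
  moreover have "g (\<Sum>r\<in>Poly_Mapping.keys y. r * Poly_Mapping.lookup y r) = g f"
    using y by (intro periodic_Ints[where g = g, OF periodic]) (simp add: group_solutions_def)
  ultimately show "1 \<le> cost g y" using f by simp
qed (rule nonneg)

section \<open>Summands of a convex decomposition\<close>

text \<open>
  A convex decomposition of a symmetric function forces equality in every instance
  \<open>x + y \<equiv> f\<close> of validity, so each summand inherits periodicity and symmetry at once.
\<close>

lemma decomposition_symmetric:
  assumes "valid_function f g" "valid_function f h"
    and "\<And>x. \<pi> x = 1/2 * (g x + h x)"
    and "\<And>x. \<pi> (x + 1) = \<pi> x" "\<And>x. \<pi> x + \<pi> (f - x) = 1"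
    and "x + y - f \<in> \<int>"
  shows "g x + g y = 1"
proof -
  have "\<pi> y = \<pi> (f - x)"
    using assms(6) by (intro periodic_Ints[where g = \<pi>, OF assms(4)]) (simp add: algebra_simps)
  then have "g x + h x + (g y + h y) = 2"
    using assms(3)[of x] assms(3)[of y] assms(5)[of x] by simp
  then show ?thesis
    using valid_function_pair[OF assms(1,6)] valid_function_pair[OF assms(2,6)] by simp
qed

text \<open>Both \<open>x\<close> and \<open>x + 1\<close> are complementary to \<open>f - x\<close>
  modulo 1, so both values are \<open>1 - g (f - x)\<close>.\<close>

lemma decomposition_periodic:
  assumes "valid_function f g" "valid_function f h"
    and "\<And>x. \<pi> x = 1/2 * (g x + h x)"
    and "\<And>x. \<pi> (x + 1) = \<pi> x" "\<And>x. \<pi> x + \<pi> (f - x) = 1"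
  shows "g (x + 1) = g x"
  using decomposition_symmetric[OF assms, of x "f - x"]
    decomposition_symmetric[OF assms, of "x + 1" "f - x"] by simp

lemma decomposition_subadditive:
  assumes "valid_function f g" "valid_function f h"
    and "\<And>x. \<pi> x = 1/2 * (g x + h x)"
    and "\<And>x. \<pi> (x + 1) = \<pi> x" "\<And>x. \<pi> x + \<pi> (f - x) = 1"
  shows "g (x + y) \<le> g x + g y"
  using decomposition_symmetric[OF assms, of "x + y" "f - (x + y)"]
    valid_function_triple[OF assms(1), of x y "f - (x + y)"] by simp

text \<open>Both summands are subadditive, so equality for their average leaves no slack in
  either.\<close>

lemma decomposition_additive:
  assumes "valid_function f g" "valid_function f h"
    and "\<And>x. \<pi> x = 1/2 * (g x + h x)"
    and "\<And>x. \<pi> (x + 1) = \<pi> x" "\<And>x. \<pi> x + \<pi> (f - x) = 1"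
    and "\<pi> x + \<pi> y = \<pi> (x + y)"
  shows "g x + g y = g (x + y)"
proof -
  have comm: "\<And>x. \<pi> x = 1/2 * (h x + g x)" using assms(3) by simp
  show ?thesis
    using decomposition_subadditive[OF assms(1-5), of x y]
      decomposition_subadditive[OF assms(2,1) comm assms(4,5), of x y]
      assms(3)[of x] assms(3)[of y] assms(3)[of "x + y"] assms(6) by simp
qed

text \<open>Subadditivity and \<open>0 \<le> g t \<le> 2 * \<pi> t\<close> bound the increments of
  \<open>g\<close> at any point by values of \<open>\<pi>\<close> near 0, so continuity of
  \<open>\<pi>\<close> at 0 spreads to \<open>g\<close> everywhere.\<close>

lemma decomposition_continuous:
  assumes "valid_function f g" "valid_function f h"
    and "\<And>x. \<pi> x = 1/2 * (g x + h x)"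
    and "\<And>x. \<pi> (x + 1) = \<pi> x" "\<And>x. \<pi> x + \<pi> (f - x) = 1"
    and "\<pi> 0 = 0" "isCont \<pi> 0"
  shows "isCont g x"
proof -
  have le: "g t \<le> 2 * \<pi> t" for t
  proof -
    have "0 \<le> h t" using assms(2) by (simp add: valid_function_iff)
    then show ?thesis using assms(3)[of t] by simp
  qed
  have nonneg: "0 \<le> g t" for t
    using assms(1) by (simp add: valid_function_iff)
  have bound: "\<bar>g (x + t) - g x\<bar> \<le> 2 * \<pi> t + 2 * \<pi> (- t)" for t
    using decomposition_subadditive[OF assms(1-5), of x t]
      decomposition_subadditive[OF assms(1-5), of "x + t" "- t"] le[of t] le[of "- t"]
      nonneg[of t] nonneg[of "- t"] by simp
  have lim: "(\<pi> \<longlongrightarrow> 0) (at 0)"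
    using assms(6,7) by (simp add: isCont_def)
  have "((\<lambda>t. \<pi> (- t)) \<longlongrightarrow> 0) (at 0)"
    using isCont_o2[of 0 uminus \<pi>, OF isCont_minus[OF continuous_ident]] assms(6,7)
    by (simp add: isCont_def)
  from tendsto_add[OF tendsto_mult_left[OF lim, of 2] tendsto_mult_left[OF this, of 2]]
  have "((\<lambda>t. 2 * \<pi> t + 2 * \<pi> (- t)) \<longlongrightarrow> 0) (at 0)"
    by simp
  with eventuallyI have "((\<lambda>t. g (x + t) - g x) \<longlongrightarrow> 0) (at 0)"
    by (rule Lim_null_comparison) (simp add: bound)
  then have "((\<lambda>t. g (x + t)) \<longlongrightarrow> g x) (at 0)"
    by (simp add: LIM_zero_iff)
  then show ?thesis by (simp add: isCont_iff)
qed

subsection \<open>The interval lemma\<close>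

text \<open>Equal consecutive increments make \<open>g\<close> affine on every equidistant grid of
  mesh at most \<open>\<epsilon>\<close>; grid points approximate every \<open>x\<close>, and
  continuity does the rest.\<close>

lemma affine_if_locally_midpoint_affine:
  fixes g :: "real \<Rightarrow> real"
  assumes cont: "continuous_on {l..u} g" and lu: "l < u" and \<epsilon>: "0 < \<epsilon>"
    and mid: "\<And>x h. l \<le> x \<Longrightarrow> 0 \<le> h \<Longrightarrow> h \<le> \<epsilon> \<Longrightarrow> x + 2 * h \<le> u \<Longrightarrow>
                g (x + h) - g x = g (x + 2 * h) - g (x + h)"
    and x: "x \<in> {l..u}"
  shows "g x = g l + (g u - g l) / (u - l) * (x - l)"
proof -
  define \<sigma> where "\<sigma> = (g u - g l) / (u - l)"
  have grid: "g (l + real k * ((u - l) / real N)) = g l + \<sigma> * (real k * ((u - l) / real N))"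
    if k: "k \<le> N" and N: "0 < N" "(u - l) / real N \<le> \<epsilon>" for k N
  proof -
    define h where "h = (u - l) / real N"
    have h: "0 \<le> h" "h \<le> \<epsilon>" "real N * h = u - l" using N lu by (auto simp: h_def)
    have step: "Suc j \<le> N \<Longrightarrow> g (l + real (Suc j) * h) - g (l + real j * h) = g (l + h) - g l" for j
    proof (induction j)
      case (Suc j)
      have "real (j + 2) * h \<le> real N * h" using Suc.prems h by (intro mult_right_mono) auto
      then have "g (l + real j * h + h) - g (l + real j * h)
          = g (l + real j * h + 2 * h) - g (l + real j * h + h)"
        using h by (intro mid) (auto simp: algebra_simps)
      then show ?case using Suc by (simp add: algebra_simps)
    qed simp
    have lin: "j \<le> N \<Longrightarrow> g (l + real j * h) = g l + real j * (g (l + h) - g l)" for j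
    proof (induction j)
      case (Suc j)
      then show ?case using step[of j] by (simp add: algebra_simps)
    qed simp
    have "g u - g l = real N * (g (l + h) - g l)"
      using lin[of N] h(3) by simp
    then have "\<sigma> * h = g (l + h) - g l"
      using N lu by (simp add: \<sigma>_def h_def)
    then show ?thesis
      using lin[OF k] by (simp add: h_def[symmetric] mult.left_commute)
  qed
  define t where "t = (x - l) / (u - l)"
  have t: "0 \<le> t" "t \<le> 1" "x = l + t * (u - l)" using x lu by (auto simp: t_def)
  \<comment> \<open>The last point not beyond \<open>x\<close> of the grid with \<open>N\<close>
    steps. For \<open>N = 0\<close> division by zero gives \<open>X 0 = l\<close>, which still lies
    in the interval.\<close>
  define X where "X = (\<lambda>N. l + real (nat \<lfloor>t * real N\<rfloor>) * ((u - l) / real N))"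
  have frac: "(\<lambda>N. real (nat \<lfloor>t * real N\<rfloor>) / real N) \<longlonglongrightarrow> t"
  proof (rule tendsto_sandwich)
    show "(\<lambda>N. t - 1 / real N) \<longlonglongrightarrow> t"
      using tendsto_diff[OF tendsto_const lim_1_over_n, of t] by simp
    show "\<forall>\<^sub>F N in sequentially. t - 1 / real N \<le> real (nat \<lfloor>t * real N\<rfloor>) / real N"
      using eventually_gt_at_top[of 0]
    proof eventually_elim
      case (elim N)
      have "t * real N - 1 \<le> real (nat \<lfloor>t * real N\<rfloor>)" using t by linarith
      from divide_right_mono[OF this, of "real N"] show ?case
        using elim by (simp add: diff_divide_distrib)
    qed
    show "\<forall>\<^sub>F N in sequentially. real (nat \<lfloor>t * real N\<rfloor>) / real N \<le> t"
      using eventually_gt_at_top[of 0]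
    proof eventually_elim
      case (elim N)
      have "real (nat \<lfloor>t * real N\<rfloor>) \<le> t * real N" using t by simp
      then show ?case using elim by (simp add: field_simps)
    qed
  qed simp
  have X: "X \<longlonglongrightarrow> x"
    using tendsto_add[OF tendsto_const tendsto_mult[OF frac tendsto_const], of l "u - l"]
    by (simp add: X_def t(3))
  have kN: "nat \<lfloor>t * real N\<rfloor> \<le> N" for N
  proof -
    have "t * real N \<le> 1 * real N" using t by (intro mult_right_mono) auto
    then show ?thesis by linarith
  qed
  have X_in: "X N \<in> {l..u}" for N
  proof (cases "N = 0")
    case False
    have "real (nat \<lfloor>t * real N\<rfloor>) * ((u - l) / real N) \<le> real N * ((u - l) / real N)"
      using kN[of N] lu by (intro mult_right_mono) auto
    then show ?thesis using False lu by (simp add: X_def)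
  qed (use lu in \<open>simp add: X_def\<close>)
  have "(\<lambda>N. g (X N)) \<longlonglongrightarrow> g x"
    using continuous_on_tendsto_compose[OF cont X x] X_in by simp
  moreover have "\<forall>\<^sub>F N in sequentially. g (X N) = g l + \<sigma> * (X N - l)"
  proof -
    have "(\<lambda>N. (u - l) / real N) \<longlonglongrightarrow> 0"
      by (rule lim_const_over_n)
    then have "\<forall>\<^sub>F N in sequentially. (u - l) / real N < \<epsilon>"
      using \<epsilon> by (rule order_tendstoD)
    then show ?thesis
      using eventually_gt_at_top[of 0]
    proof eventually_elim
      case (elim N)
      then show ?case using grid[OF kN[of N], of] by (simp add: X_def)
    qed
  qed
  ultimately have "(\<lambda>N. g l + \<sigma> * (X N - l)) \<longlonglongrightarrow> g x"
    by (rule Lim_transform_eventually)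
  moreover have "(\<lambda>N. g l + \<sigma> * (X N - l)) \<longlonglongrightarrow> g l + \<sigma> * (x - l)"
    by (intro tendsto_intros X)
  ultimately show ?thesis
    unfolding \<sigma>_def by (rule LIMSEQ_unique)
qed

text \<open>Additivity is given only on a strip of the square. Trading a small \<open>h\<close>
  between the two arguments keeps their sum, so the increments of \<open>g\<close> at
  \<open>x\<close> and at \<open>x + h\<close> both equal the increment at one auxiliary point
  \<open>y\<close>.\<close>

lemma interval_lemma:
  fixes g G :: "real \<Rightarrow> real"
  assumes cont: "continuous_on {l..u} g"
    and m: "m \<le> l + u" "l + u \<le> M" "m < M"
    and add: "\<And>x y. x \<in> {l..u} \<Longrightarrow> y \<in> {l..u} \<Longrightarrow> x + y \<in> {m..M} \<Longrightarrow> g x + g y = G (x + y)"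
  shows "\<exists>\<sigma>. \<forall>x\<in>{l..u}. g x = g l + \<sigma> * (x - l)"
proof (cases "l < u")
  case True
  have "g (x + h) - g x = g (x + 2 * h) - g (x + h)"
    if "l \<le> x" "0 \<le> h" "h \<le> M - m" "x + 2 * h \<le> u" for x h
  proof -
    \<comment> \<open>The least \<open>y \<ge> l\<close> with \<open>m \<le> x + y + h\<close>; the
      bounds on \<open>l + u\<close> and \<open>h \<le> M - m\<close> then keep \<open>y + h\<close>
      and \<open>x + y + 2 * h\<close> in range.\<close>
    define y where "y = max m (x + h + l) - x - h"
    have y: "l \<le> y" "y + h \<le> u" "m \<le> x + y + h" "x + y + 2 * h \<le> M"
      using that m unfolding y_def by (auto simp: max_def)
    show ?thesis
      using add[of x "y + h"] add[of "x + h" y] add[of "x + h" "y + h"] add[of "x + 2 * h" y] y that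
      by (simp add: algebra_simps)
  qed
  then have "g x = g l + (g u - g l) / (u - l) * (x - l)" if "x \<in> {l..u}" for x
    using m(3) that by (intro affine_if_locally_midpoint_affine[OF cont True, of "M - m"]) simp_all
  then show ?thesis by blast
next
  case False
  then have "g x = g l + 0 * (x - l)" if "x \<in> {l..u}" for x
    using that by (cases "x = l") auto
  then show ?thesis by blast
qed

subsection \<open>The three-slope function\<close>

text \<open>A form of the data without divisions. Since \<open>2 * C\<close> is congruent to
  \<open>f - b\<close>, the assumption \<open>w\<close> is additivity at \<open>(C, C)\<close>;
  \<open>key\<close> is additivity at \<open>(f + a, C)\<close>, and \<open>v\<close> matches the
  pieces at \<open>f + a\<close>. The point \<open>1 + f - C\<close> is the mirror image of
  \<open>C\<close> under \<open>x \<mapsto> 1 + f - x\<close>.\<close>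

locale three_slope =
  fixes f a b C w s1 s2 s3 :: real and \<pi> :: "real \<Rightarrow> real"
  assumes f: "0 < f" "2 * f < 1"
    and ab: "0 \<le> a" "0 \<le> b" "b \<le> f" "3 * f + 4 * a - b \<le> 1"
    and C: "2 * C = 1 + f - b"
    and s1: "s1 * f = 1" and w: "2 * w = 1 - s1 * b"
    and v: "1 + s2 * a = w + s3 * (f + a - C)"
    and key: "3 * w - 1 = s3 * (C - b)"
    and slopes: "s2 \<le> s3" "s3 \<le> s1"
    and periodic: "\<pi> (x + 1) = \<pi> x"
    and piece1: "0 \<le> x \<Longrightarrow> x \<le> f \<Longrightarrow> \<pi> x = s1 * x"
    and piece2: "f \<le> x \<Longrightarrow> x \<le> f + a \<Longrightarrow> \<pi> x = 1 + s2 * (x - f)"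
    and piece3: "f + a \<le> x \<Longrightarrow> x \<le> C \<Longrightarrow> \<pi> x = w + s3 * (x - C)"
    and piece4: "C \<le> x \<Longrightarrow> x \<le> 1 + f - C \<Longrightarrow> \<pi> x = w + s1 * (x - C)"
    and piece5: "1 + f - C \<le> x \<Longrightarrow> x \<le> 1 - a \<Longrightarrow> \<pi> x = 1 - w + s3 * (x - (1 + f - C))"
    and piece6: "1 - a \<le> x \<Longrightarrow> x \<le> 1 \<Longrightarrow> \<pi> x = s2 * (x - 1)"
begin

lemma shift: "x - y \<in> \<int> \<Longrightarrow> \<pi> x = \<pi> y"
  by (rule periodic_Ints[where g = \<pi>, OF periodic])

lemma order: "f + a < C" "C \<le> 1 + f - C" "1 + f - C < 1 - a" "C < 1" "0 < 1 - C"
  "2 * (f + a) \<le> 1 + f - C" "1 + f - C \<le> f + a + C" "f + a + C \<le> 1 - a"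
  "1 - a \<le> 2 * C" "0 < C - b"
  using f ab C by simp_all

lemma s1_C: "2 * (s1 * C) = s1 + 1 - s1 * b"
proof -
  have "s1 * (2 * C) = s1 * (1 + f - b)" using C by simp
  then show ?thesis using s1 by (simp add: algebra_simps)
qed

lemma s3_C: "2 * (s3 * C) = s3 + s3 * f - s3 * b"
proof -
  have "s3 * (2 * C) = s3 * (1 + f - b)" using C by simp
  then show ?thesis by (simp add: algebra_simps)
qed

lemma s1_pos: "0 < s1"
  using zero_less_mult_pos2[of s1 f] s1 f(1) by simp

lemma w_nonneg: "0 \<le> w"
proof -
  have "s1 * b \<le> s1 * f" using s1_pos ab by (intro mult_left_mono) auto
  then show ?thesis using w s1 by simp
qed

lemma zero: "\<pi> 0 = 0" and at_f: "\<pi> f = 1"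
  and at_fa: "\<pi> (f + a) = w + s3 * (f + a - C)" and at_C: "\<pi> C = w"
  using piece1[of 0] piece1[of f] piece3[of "f + a"] piece4[of C] f s1 order by simp_all

text \<open>By \<open>w\<close>, \<open>s1 * b = 1 - 2 * w\<close>, so \<open>key\<close> yields the
  bound. It says that the line carrying the piece on \<open>[f + a, C]\<close> is nonnegative at
  0.\<close>

lemma w_ge: "s3 * C \<le> w"
proof -
  have "s3 * b \<le> s1 * b" using slopes ab by (intro mult_right_mono) auto
  then show ?thesis using key w by (simp add: algebra_simps)
qed

lemma at_fa_nonneg: "0 \<le> \<pi> (f + a)"
proof (cases "s3 \<le> 0")
  case True
  then have "0 \<le> s3 * (f + a - C)" using order by (intro mult_nonpos_nonpos) auto
  then show ?thesis using at_fa w_nonneg by simp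
next
  case False
  then have "0 \<le> s3 * (f + a)" using f ab by simp
  then show ?thesis using at_fa w_ge by (simp add: algebra_simps)
qed

text \<open>The reflection preserves \<open>[0, f]\<close>; on the rest of the period it is
  \<open>y \<mapsto> 1 + f - y\<close>, which swaps pieces 2 and 6, swaps 3 and 5, and preserves
  4.\<close>

lemma symmetric: "\<pi> x + \<pi> (f - x) = 1"
proof -
  define y where "y = frac x"
  have y: "0 \<le> y" "y \<le> 1" by (simp_all add: y_def frac_lt_1 less_imp_le)
  have xy: "x - y \<in> \<int>" by (simp add: y_def frac_def)
  have "\<pi> y + \<pi> (f - y) = 1"
  proof (cases "y \<le> f")
    case True
    then show ?thesis using piece1[of y] piece1[of "f - y"] y s1 by (simp add: algebra_simps)
  next
    case False
    have "\<pi> y + \<pi> (1 + f - y) = 1"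
    proof -
      consider "f \<le> y" "y \<le> f + a" | "f + a \<le> y" "y \<le> C" | "C \<le> y" "y \<le> 1 + f - C"
        | "1 + f - C \<le> y" "y \<le> 1 - a" | "1 - a \<le> y" "y \<le> 1"
        using False y by linarith
      then show ?thesis
      proof cases
        case 1
        then show ?thesis using piece2[of y] piece6[of "1 + f - y"] by (simp add: algebra_simps)
      next
        case 2
        then show ?thesis using piece3[of y] piece5[of "1 + f - y"] by (simp add: algebra_simps)
      next
        case 3
        then show ?thesis
          using piece4[of y] piece4[of "1 + f - y"] s1_C s1 w by (simp add: algebra_simps)
      next
        case 4
        then show ?thesis using piece5[of y] piece3[of "1 + f - y"] by (simp add: algebra_simps)
      next
        case 5
        then show ?thesis using piece6[of y] piece2[of "1 + f - y"] by (simp add: algebra_simps)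
      qed
    qed
    moreover have "\<pi> (1 + f - y) = \<pi> (f - y)" by (intro shift) simp
    ultimately show ?thesis by simp
  qed
  moreover have "\<pi> x = \<pi> y" using xy by (rule shift)
  moreover have "\<pi> (f - x) = \<pi> (f - y)"
    using Ints_minus[OF xy] by (intro shift) simp
  ultimately show ?thesis by simp
qed

section \<open>Concave arcs and supporting lines\<close>

lemma left_bounds:
  assumes "0 \<le> x" "x \<le> f + a"
  shows "\<pi> x \<le> s1 * x" "\<pi> x \<le> 1 + s2 * (x - f)"
proof -
  have "(s1 - s2) * (x - f) \<ge> 0 \<and> \<pi> x = 1 + s2 * (x - f) \<or>
        (s1 - s2) * (f - x) \<ge> 0 \<and> \<pi> x = s1 * x"
    using piece1[of x] piece2[of x] assms slopes by (cases "x \<le> f") auto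
  then show "\<pi> x \<le> s1 * x" "\<pi> x \<le> 1 + s2 * (x - f)"
    using s1 by (auto simp: algebra_simps)
qed

lemma right_bounds:
  assumes "C \<le> x" "x \<le> 1"
  shows "\<pi> x \<le> w + s1 * (x - C)" "\<pi> x \<le> 1 - w + s3 * (x - (1 + f - C))" "\<pi> x \<le> s2 * (x - 1)"
proof -
  let ?D = "1 + f - C"
  \<comment> \<open>\<open>D\<close> and \<open>E\<close> compare neighbouring lines, which cross at
    the breakpoints \<open>1 + f - C\<close> and \<open>1 - a\<close>; the order of the slopes gives
    the signs.\<close>
  have D: "w + s1 * (x - C) - (1 - w + s3 * (x - ?D)) = (s1 - s3) * (x - ?D)"
    using s1_C s1 w by (simp add: algebra_simps)
  have E: "1 - w + s3 * (x - ?D) - s2 * (x - 1) = (s3 - s2) * (x - (1 - a))"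
    using v by (simp add: algebra_simps)
  consider "x \<le> ?D" | "?D \<le> x" "x \<le> 1 - a" | "1 - a \<le> x" by linarith
  then have "\<pi> x \<le> w + s1 * (x - C) \<and> \<pi> x \<le> 1 - w + s3 * (x - ?D) \<and> \<pi> x \<le> s2 * (x - 1)"
  proof cases
    case 1
    then have "(s1 - s3) * (x - ?D) \<le> 0" "(s3 - s2) * (x - (1 - a)) \<le> 0"
      using slopes order by (auto intro!: mult_nonneg_nonpos)
    then show ?thesis using D E piece4[OF assms(1) 1] by linarith
  next
    case 2
    then have "0 \<le> (s1 - s3) * (x - ?D)" "(s3 - s2) * (x - (1 - a)) \<le> 0"
      using slopes by (auto intro!: mult_nonneg_nonpos)
    then show ?thesis using D E piece5[OF 2] by linarith
  next
    case 3
    then have "0 \<le> (s1 - s3) * (x - ?D)" "0 \<le> (s3 - s2) * (x - (1 - a))"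
      using slopes order by auto
    then show ?thesis using D E piece6[OF 3 assms(2)] by linarith
  qed
  then show "\<pi> x \<le> w + s1 * (x - C)" "\<pi> x \<le> 1 - w + s3 * (x - ?D)" "\<pi> x \<le> s2 * (x - 1)"
    by blast+
qed

text \<open>All convex kinks of \<open>\<pi>\<close> are among these points, so \<open>\<pi>\<close>
  is concave between neighbouring ones.\<close>

definition vertex :: "real \<Rightarrow> bool" where
  "vertex x \<longleftrightarrow> (\<exists>v\<in>{0, f + a, C}. x - v \<in> \<int>)"

text \<open>The line carrying the piece through \<open>z\<close> works: by concavity it dominates
  \<open>\<pi>\<close> on the whole arc \<open>[0, f + a]\<close>, \<open>[f + a, C]\<close> or
  \<open>[C, 1]\<close> around \<open>z\<close>.\<close>

lemma supporting_line_01: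
  assumes "0 \<le> z" "z \<le> 1"
  shows "\<exists>l u c. l \<le> z \<and> z \<le> u \<and> vertex l \<and> vertex u \<and> (\<forall>x\<in>{l..u}. \<pi> x \<le> \<pi> z + c * (x - z))"
proof -
  have V: "vertex 0" "vertex 1" "vertex (f + a)" "vertex C"
    by (auto simp: vertex_def)
  consider "z \<le> f" | "f \<le> z" "z \<le> f + a" | "f + a \<le> z" "z \<le> C" | "C \<le> z" "z \<le> 1 + f - C"
    | "1 + f - C \<le> z" "z \<le> 1 - a" | "1 - a \<le> z"
    using assms by linarith
  then show ?thesis
  proof cases
    case 1
    have "\<pi> x \<le> \<pi> z + s1 * (x - z)" if "x \<in> {0..f + a}" for x
      using left_bounds(1)[of x] piece1[OF assms(1) 1] that by (simp add: algebra_simps)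
    with V show ?thesis using 1 assms ab by (intro exI[of _ 0] exI[of _ "f + a"] exI[of _ s1]) simp
  next
    case 2
    have "\<pi> x \<le> \<pi> z + s2 * (x - z)" if "x \<in> {0..f + a}" for x
      using left_bounds(2)[of x] piece2[OF 2] that by (simp add: algebra_simps)
    with V show ?thesis using 2 assms by (intro exI[of _ 0] exI[of _ "f + a"] exI[of _ s2]) simp
  next
    case 3
    have "\<pi> x \<le> \<pi> z + s3 * (x - z)" if "x \<in> {f + a..C}" for x
      using piece3[of x] piece3[OF 3] that by (simp add: algebra_simps)
    with V show ?thesis using 3 by (intro exI[of _ "f + a"] exI[of _ C] exI[of _ s3]) simp
  next
    case 4
    have "\<pi> x \<le> \<pi> z + s1 * (x - z)" if "x \<in> {C..1}" for x
      using right_bounds(1)[of x] piece4[OF 4] that by (simp add: algebra_simps)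
    with V show ?thesis using 4 assms by (intro exI[of _ C] exI[of _ 1] exI[of _ s1]) simp
  next
    case 5
    have "\<pi> x \<le> \<pi> z + s3 * (x - z)" if "x \<in> {C..1}" for x
      using right_bounds(2)[of x] piece5[OF 5] that by (simp add: algebra_simps)
    with V show ?thesis using 5 assms order by (intro exI[of _ C] exI[of _ 1] exI[of _ s3]) simp
  next
    case 6
    have "\<pi> x \<le> \<pi> z + s2 * (x - z)" if "x \<in> {C..1}" for x
      using right_bounds(3)[of x] piece6[OF 6 assms(2)] that by (simp add: algebra_simps)
    with V show ?thesis using 6 assms order by (intro exI[of _ C] exI[of _ 1] exI[of _ s2]) simp
  qed
qed

lemma supporting_line:
  "\<exists>l u c. l \<le> z \<and> z \<le> u \<and> vertex l \<and> vertex u \<and> (\<forall>x\<in>{l..u}. \<pi> x \<le> \<pi> z + c * (x - z))"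
proof -
  have "0 \<le> frac z" "frac z \<le> 1" by (simp_all add: frac_lt_1 less_imp_le)
  from supporting_line_01[OF this] obtain l u c where luc: "l \<le> frac z" "frac z \<le> u" "vertex l" "vertex u"
    "\<forall>x\<in>{l..u}. \<pi> x \<le> \<pi> (frac z) + c * (x - frac z)"
    by blast
  define n where "n = real_of_int \<lfloor>z\<rfloor>"
  have z: "z = frac z + n" by (simp add: frac_def n_def)
  have n: "n \<in> \<int>" by (simp add: n_def)
  have vertex_add: "vertex (y + n)" if "vertex y" for y
  proof -
    obtain v0 where v0: "v0 \<in> {0, f + a, C}" "y - v0 \<in> \<int>" using \<open>vertex y\<close> unfolding vertex_def by blast
    have "y + n - v0 \<in> \<int>" using Ints_add[OF v0(2) n] by (simp add: algebra_simps)
    then show ?thesis using v0(1) unfolding vertex_def by blast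
  qed
  have "\<pi> x \<le> \<pi> z + c * (x - z)" if "l + n \<le> x" "x \<le> u + n" for x
  proof -
    have "\<pi> x = \<pi> (x - n)" "\<pi> z = \<pi> (frac z)"
      using n by (intro shift; simp add: frac_def)+
    moreover have "\<pi> (x - n) \<le> \<pi> (frac z) + c * (x - n - frac z)" using luc(5) that by simp
    moreover have "x - n - frac z = x - z" using z by simp
    ultimately show ?thesis by simp
  qed
  with luc vertex_add z show ?thesis
    by (intro exI[of _ "l + n"] exI[of _ "u + n"] exI[of _ c]) auto
qed

section \<open>Sliding to vertices and subadditivity\<close>

text \<open>
  Moving \<open>p\<close> and \<open>q\<close> in opposite directions stays below both supporting lines, whose sum is an
  affine function of the displacement; so one of the two directions does not increase the sum.
\<close>

lemma slide_to_vertex: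
  obtains p' q' where "p' + q' = p + q" "\<pi> p' + \<pi> q' \<le> \<pi> p + \<pi> q" "vertex p' \<or> vertex q'"
proof -
  obtain l u c where p: "l \<le> p" "p \<le> u" "vertex l" "vertex u"
    "\<forall>x\<in>{l..u}. \<pi> x \<le> \<pi> p + c * (x - p)"
    using supporting_line[of p] by blast
  obtain m n d where q: "m \<le> q" "q \<le> n" "vertex m" "vertex n"
    "\<forall>x\<in>{m..n}. \<pi> x \<le> \<pi> q + d * (x - q)"
    using supporting_line[of q] by blast
  \<comment> \<open>The longest displacement in the favourable direction that keeps both points on
    their arcs; it stops when one of them reaches an endpoint.\<close>
  define t where "t = (if c \<le> d then min (u - p) (q - m) else max (l - p) (q - n))"
  have t: "l \<le> p + t" "p + t \<le> u" "m \<le> q - t" "q - t \<le> n" "(c - d) * t \<le> 0"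
    using p q by (auto simp: t_def mult_le_0_iff)
  have "\<pi> (p + t) + \<pi> (q - t) \<le> \<pi> p + \<pi> q"
    using bspec[OF p(5), of "p + t"] bspec[OF q(5), of "q - t"] t by (simp add: algebra_simps)
  moreover have "vertex (p + t) \<or> vertex (q - t)"
    using p q by (auto simp: t_def min_def max_def)
  ultimately show ?thesis by (intro that[of "p + t" "q - t"]) auto
qed

text \<open>If \<open>2 * (f + a)\<close> lies on piece 3, the slack is \<open>w - s3 * C\<close>.
  On piece 4 it is \<open>(s1 - s3) * (C + b - 2 * (f + a))\<close>, whose sign is the hypothesis
  \<open>3 * f + 4 * a - b \<le> 1\<close>.\<close>

lemma double_fa: "\<pi> (2 * (f + a)) \<le> 2 * \<pi> (f + a)"
proof (cases "2 * (f + a) \<le> C")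
  case True
  then have "\<pi> (2 * (f + a)) = w + s3 * (2 * (f + a) - C)"
    using piece3[of "2 * (f + a)"] f ab by simp
  then show ?thesis using at_fa w_ge by (simp add: algebra_simps)
next
  case False
  then have "\<pi> (2 * (f + a)) = w + s1 * (2 * (f + a) - C)"
    using piece4[of "2 * (f + a)"] order by simp
  moreover have "0 \<le> (s1 - s3) * (C + b - 2 * (f + a))"
    using slopes order C by (intro mult_nonneg_nonneg) auto
  ultimately show ?thesis using at_fa key w by (simp add: algebra_simps)
qed

text \<open>All three points lie on lines of slope \<open>s3\<close>, so the slack is constant on
  this region, and \<open>key\<close> makes it zero.\<close>

lemma additive_slope3:
  assumes "x \<in> {f + a..C}" "y \<in> {f + a..C}" "x + y \<in> {1 + f - C..1 - a}"
  shows "\<pi> x + \<pi> y = \<pi> (x + y)"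
  using piece3[of x] piece3[of y] piece5[of "x + y"] assms key s3_C by (simp add: algebra_simps)

lemma double_C: "\<pi> C + \<pi> C = \<pi> (C + C)"
proof -
  have "\<pi> (C + C) = \<pi> (f - b)"
    using C by (intro shift) (simp add: algebra_simps)
  then show ?thesis using piece1[of "f - b"] ab at_C s1 w by (simp add: algebra_simps)
qed

text \<open>Symmetry turns the claim into subadditivity at \<open>(p, q)\<close>, and modulo 1 only
  finitely many pairs occur; those containing 0 are trivial.\<close>

lemma triple_vertices:
  assumes "p + q + r = f" "vertex p" "vertex q"
  shows "1 \<le> \<pi> p + \<pi> q + \<pi> r"
proof -
  obtain p' q' where p': "p' \<in> {0, f + a, C}" "p - p' \<in> \<int>" and q': "q' \<in> {0, f + a, C}" "q - q' \<in> \<int>"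
    using assms(2,3) unfolding vertex_def by blast
  have "\<pi> p = \<pi> p'" "\<pi> q = \<pi> q'" using p' q' shift by blast+
  moreover have "\<pi> r = \<pi> (f - (p' + q'))"
  proof (rule shift)
    have "r - (f - (p' + q')) = - ((p - p') + (q - q'))" using assms(1) by simp
    then show "r - (f - (p' + q')) \<in> \<int>" using p' q' by (simp only: Ints_minus Ints_add)
  qed
  moreover have "\<pi> (p' + q') \<le> \<pi> p' + \<pi> q'"
    using p'(1) q'(1) zero double_fa double_C additive_slope3[of "f + a" C] order
    by (auto simp: algebra_simps)
  ultimately show ?thesis using symmetric[of "p' + q'"] by simp
qed

lemma triple_vertex:
  assumes "p + q + r = f" "vertex p"
  shows "1 \<le> \<pi> p + \<pi> q + \<pi> r"
proof -
  obtain q' r' where *: "q' + r' = q + r" "\<pi> q' + \<pi> r' \<le> \<pi> q + \<pi> r" "vertex q' \<or> vertex r'"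
    by (rule slide_to_vertex)
  then have "1 \<le> \<pi> p + \<pi> q' + \<pi> r'"
    using triple_vertices[of p q' r'] triple_vertices[of p r' q'] assms by (auto simp: algebra_simps)
  with * show ?thesis by simp
qed

text \<open>Sliding \<open>p\<close> against \<open>q\<close> produces a first vertex;
  \<open>triple_vertex\<close> slides the other two arguments to obtain a second.\<close>

lemma triple:
  assumes "p + q + r = f"
  shows "1 \<le> \<pi> p + \<pi> q + \<pi> r"
proof -
  obtain p' q' where *: "p' + q' = p + q" "\<pi> p' + \<pi> q' \<le> \<pi> p + \<pi> q" "vertex p' \<or> vertex q'"
    by (rule slide_to_vertex)
  then have "1 \<le> \<pi> p' + \<pi> q' + \<pi> r"
    using triple_vertex[of p' q' r] triple_vertex[of q' p' r] assms by (auto simp: algebra_simps)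
  with * show ?thesis by simp
qed

lemma subadditive: "\<pi> (x + y) \<le> \<pi> x + \<pi> y"
  using triple[of x y "f - (x + y)"] symmetric[of "x + y"] by simp

text \<open>Following the supporting line at \<open>x\<close> in its nonincreasing direction leads
  to a vertex with no larger value, and the values at vertices are nonnegative.\<close>

lemma nonneg: "0 \<le> \<pi> x"
proof -
  obtain l u c where luc: "l \<le> x" "x \<le> u" "vertex l" "vertex u"
    "\<forall>y\<in>{l..u}. \<pi> y \<le> \<pi> x + c * (y - x)"
    using supporting_line[of x] by blast
  have vertex: "0 \<le> \<pi> y" if "vertex y" for y
  proof -
    obtain v0 where v0: "v0 \<in> {0, f + a, C}" "y - v0 \<in> \<int>"
      using \<open>vertex y\<close> unfolding vertex_def by blast
    have "0 \<le> \<pi> v0" using v0(1) zero at_fa_nonneg at_C w_nonneg by auto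
    then show ?thesis using shift[OF v0(2)] by simp
  qed
  show ?thesis
  proof (cases "0 \<le> c")
    case True
    then have "c * (l - x) \<le> 0" using luc(1) by (simp add: mult_nonneg_nonpos)
    then show ?thesis using bspec[OF luc(5), of l] luc(1,2) vertex[OF luc(3)] by simp
  next
    case False
    then have "c * (u - x) \<le> 0" using luc(2) by (simp add: mult_nonpos_nonneg)
    then show ?thesis using bspec[OF luc(5), of u] luc(1,2) vertex[OF luc(4)] by simp
  qed
qed

lemma valid: "valid_function f \<pi>"
  by (rule valid_function_if_subadditive) (fact nonneg periodic subadditive zero at_f)+

section \<open>Continuity at 0 and uniqueness of the decomposition\<close>

lemma isCont_0: "isCont \<pi> 0"
proof -
  \<comment> \<open>Within distance \<open>d\<close> of 0, \<open>x\<close> stays on the arc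
    \<open>[0, f + a]\<close>, or \<open>x + 1\<close> on the arc \<open>[C, 1]\<close>.\<close>
  define d where "d = min (f + a) (1 - C)"
  have d: "0 < d" using f ab order by (simp add: d_def)
  have bound: "\<bar>\<pi> x\<bar> \<le> (s1 + \<bar>s2\<bar>) * \<bar>x\<bar>" if "\<bar>x\<bar> < d" for x
  proof (cases "0 \<le> x")
    case True
    then have "\<pi> x \<le> s1 * x" using that left_bounds(1)[of x] by (simp add: d_def)
    moreover have "0 \<le> \<bar>s2\<bar> * x" using True by simp
    ultimately show ?thesis using nonneg[of x] True by (simp only: abs_of_nonneg distrib_right)
  next
    case False
    then have "\<pi> (x + 1) \<le> s2 * x" using that right_bounds(3)[of "x + 1"] by (simp add: d_def)
    moreover have "s2 * x \<le> \<bar>s2\<bar> * (- x)" 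
      using abs_ge_self[of "s2 * x"] False by (simp add: abs_mult)
    moreover have "0 \<le> s1 * (- x)" using False s1_pos by (intro mult_nonneg_nonneg) auto
    ultimately show ?thesis using nonneg[of x] False periodic[of x] by (simp add: algebra_simps)
  qed
  have "((\<lambda>x. (s1 + \<bar>s2\<bar>) * \<bar>x\<bar>) \<longlongrightarrow> (s1 + \<bar>s2\<bar>) * \<bar>0\<bar>) (at 0)"
    by (intro tendsto_intros)
  then have lim: "((\<lambda>x. (s1 + \<bar>s2\<bar>) * \<bar>x\<bar>) \<longlongrightarrow> 0) (at 0)" by simp
  have "\<forall>\<^sub>F x in at 0. norm (\<pi> x) \<le> (s1 + \<bar>s2\<bar>) * \<bar>x\<bar>"
    unfolding eventually_at using d bound by (intro exI[of _ d]) auto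
  from Lim_null_comparison[OF this lim] show ?thesis by (simp add: isCont_def zero)
qed

lemma decomposition_trivial:
  assumes valid: "valid_function f g" "valid_function f h"
    and dec: "\<And>x. \<pi> x = 1/2 * (g x + h x)"
  shows "g = \<pi>"
proof -
  note dec = valid dec periodic symmetric
  have sym: "g x + g (f - x) = 1" for x
    using decomposition_symmetric[where \<pi> = \<pi> and f = f and g = g and h = h, OF dec, of x "f - x"]
    by simp
  have g_periodic: "g (x + 1) = g x" for x
    by (rule decomposition_periodic[where \<pi> = \<pi> and f = f and g = g and h = h, OF dec])
  have g_shift: "x - y \<in> \<int> \<Longrightarrow> g x = g y" for x y
    by (rule periodic_Ints[where g = g, OF g_periodic])
  have add: "\<pi> x + \<pi> y = \<pi> (x + y) \<Longrightarrow> g x + g y = g (x + y)" for x y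
    by (rule decomposition_additive[where \<pi> = \<pi> and f = f and g = g and h = h, OF dec])
  have cont: "continuous_on S g" for S
    using decomposition_continuous[where \<pi> = \<pi> and f = f and g = g and h = h, OF dec zero isCont_0]
    by (simp add: continuous_at_imp_continuous_on)
  have sym': "g x + g (1 + f - x) = 1" for x
    using sym[of x] g_periodic[of "f - x"] by (simp add: algebra_simps)
  have symp: "\<pi> x + \<pi> (1 + f - x) = 1" for x
    using symmetric[of x] periodic[of "f - x"] by (simp add: algebra_simps)
  have g0: "g 0 = 0"
    using add[of 0 0] zero by simp
  have g1: "g x = \<pi> x" if "x \<in> {0..f}" for x
  proof -
    have "\<exists>\<sigma>. \<forall>x\<in>{0..f}. g x = g 0 + \<sigma> * (x - 0)"
    proof (rule interval_lemma[OF cont, of 0 0 f f g])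
      show "g x + g y = g (x + y)" if "x \<in> {0..f}" "y \<in> {0..f}" "x + y \<in> {0..f}" for x y
        using that piece1[of x] piece1[of y] piece1[of "x + y"]
        by (intro add) (simp add: algebra_simps)
    qed (use f in auto)
    then obtain \<sigma> where \<sigma>: "\<And>x. x \<in> {0..f} \<Longrightarrow> g x = g 0 + \<sigma> * (x - 0)"
      by blast
    \<comment> \<open>Symmetry at 0 gives \<open>g f = 1\<close>, which fixes the slope.\<close>
    have "\<sigma> * f = s1 * f"
      using \<sigma>[of f] g0 sym[of 0] f s1 by simp
    then show ?thesis
      using \<sigma>[OF that] g0 piece1[of x] that f by simp
  qed
  have gC: "g C = w"
    using add[OF double_C] g_shift[of "C + C" "f - b"] C g1[of "f - b"] piece1[of "f - b"] ab s1 w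
    by (simp add: algebra_simps)
  \<comment> \<open>Modulo 1, adding \<open>C\<close> moves this piece into \<open>[0, f]\<close>,
    where \<open>g\<close> is known; both pieces have slope \<open>s1\<close>, so
    \<open>\<pi>\<close> is additive at \<open>(x, C)\<close>.\<close>
  have g4: "g x = \<pi> x" if "x \<in> {C..1 + f - C}" for x
  proof -
    have x: "x + C - 1 \<in> {0..f}" using that C ab by auto
    have \<pi>: "\<pi> (x + C) = \<pi> (x + C - 1)" and g: "g (x + C) = g (x + C - 1)"
      by (intro shift g_shift; simp)+
    have "\<pi> x + \<pi> C = \<pi> (x + C)"
      using piece4[of x] at_C piece1[of "x + C - 1"] that x \<pi> s1_C s1 w by (simp add: algebra_simps)
    with add[of x C] show ?thesis using g \<pi> g1[OF x] gC at_C by simp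
  qed
  have "\<exists>\<sigma>. \<forall>x\<in>{f + a..C}. g x = g (f + a) + \<sigma> * (x - (f + a))"
  proof (rule interval_lemma[OF cont, of "1 + f - C" "f + a" C "1 - a" g])
    show "g x + g y = g (x + y)"
      if "x \<in> {f + a..C}" "y \<in> {f + a..C}" "x + y \<in> {1 + f - C..1 - a}" for x y
      using additive_slope3[OF that] by (rule add)
  qed (use order in auto)
  then obtain \<sigma> where \<sigma>: "\<And>x. x \<in> {f + a..C} \<Longrightarrow> g x = g (f + a) + \<sigma> * (x - (f + a))"
    by blast
  have eq_C: "w = g (f + a) + \<sigma> * (C - (f + a))"
    using \<sigma>[of C] gC order by simp
  \<comment> \<open>The mirror image \<open>1 - a - C\<close> of the sum lies in
    \<open>[f + a, C]\<close> again, so everything is expressed through \<open>\<sigma>\<close>. The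
    result is \<open>key\<close> with \<open>\<sigma>\<close> for \<open>s3\<close>, and
    \<open>C - b > 0\<close> can be cancelled.\<close>
  have "g (f + a) + g C = g (f + a + C)"
    using additive_slope3[of "f + a" C] order by (intro add) simp
  also have "\<dots> = 1 - g (1 - a - C)"
    using sym'[of "f + a + C"] by (simp add: algebra_simps)
  also have "\<dots> = 1 - (g (f + a) + \<sigma> * (1 - a - C - (f + a)))"
    using \<sigma>[of "1 - a - C"] order C ab f by simp
  finally have "3 * w - 1 = \<sigma> * (2 * (C - (f + a)) - (1 - a - C - (f + a)))"
    using eq_C gC by (simp add: algebra_simps)
  also have "2 * (C - (f + a)) - (1 - a - C - (f + a)) = C - b"
    using C by simp
  finally have "\<sigma> = s3"
    using key order by simp
  then have g3: "g x = \<pi> x" if "x \<in> {f + a..C}" for x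
    using \<sigma>[OF that] eq_C piece3[of x] that by (simp add: algebra_simps)
  have g_a: "g (- a) = \<pi> (- a)"
    using sym[of "f + a"] symmetric[of "f + a"] g3[of "f + a"] order by simp
  \<comment> \<open>For \<open>a = 0\<close> the range of sums would be degenerate. Otherwise
    additivity makes \<open>g\<close> affine on \<open>[-a, 0]\<close>, and its values at both ends
    are known.\<close>
  have g2: "g x = \<pi> x" if x: "x \<in> {-a..0}" for x
  proof (cases "a = 0")
    case True
    then show ?thesis using x g0 zero by simp
  next
    case False
    have \<pi>: "\<pi> x = s2 * x" if "x \<in> {-a..0}" for x
      using that piece6[of "x + 1"] periodic[of x] by simp
    have "\<exists>\<tau>. \<forall>x\<in>{-a..0}. g x = g (-a) + \<tau> * (x - (-a))"
    proof (rule interval_lemma[OF cont, of "-a" "-a" 0 0 g])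
      show "g x + g y = g (x + y)" if "x \<in> {-a..0}" "y \<in> {-a..0}" "x + y \<in> {-a..0}" for x y
        using that by (intro add) (simp add: \<pi> algebra_simps)
    qed (use ab False in auto)
    then obtain \<tau> where \<tau>: "\<And>x. x \<in> {-a..0} \<Longrightarrow> g x = g (-a) + \<tau> * (x - (-a))"
      by blast
    have "\<tau> * a = s2 * a"
      using \<tau>[of 0] \<pi>[of "-a"] g_a g0 ab by simp
    then show ?thesis
      using \<tau>[OF x] \<pi>[of "-a"] \<pi>[OF x] g_a False ab by (simp add: algebra_simps)
  qed
  have g01: "g x = \<pi> x" if x: "0 \<le> x" "x \<le> 1" for x
  proof -
    \<comment> \<open>The pieces not yet treated are reflections of the intervals of
      \<open>g2\<close> and \<open>g3\<close>, or the translate of \<open>[-a, 0]\<close> by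
      1.\<close>
    consider "x \<in> {0..f}" | "f \<le> x" "x \<le> f + a" | "x \<in> {f + a..C}" | "x \<in> {C..1 + f - C}"
      | "1 + f - C \<le> x" "x \<le> 1 - a" | "1 - a \<le> x" "x \<le> 1"
      using x by force
    then show ?thesis
    proof cases
      case 2
      then show ?thesis using sym[of x] symmetric[of x] g2[of "f - x"] by simp
    next
      case 5
      then show ?thesis using sym'[of x] symp[of x] g3[of "1 + f - x"] by simp
    next
      case 6
      then show ?thesis using g2[of "x - 1"] g_periodic[of "x - 1"] periodic[of "x - 1"] by simp
    qed (use g1 g3 g4 in auto)
  qed
  show ?thesis
  proof
    fix x
    have "g x = g (frac x)" "\<pi> x = \<pi> (frac x)"
      by (intro g_shift shift; simp add: frac_def)+
    then show "g x = \<pi> x" using g01[of "frac x"] by (simp add: frac_lt_1 less_imp_le)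
  qed
qed

lemma extreme: "extreme_function f \<pi>"
  unfolding extreme_function_def
proof (intro conjI allI impI valid)
  fix g h assume *: "valid_function f g" "valid_function f h" "\<forall>x. \<pi> x = 1/2 * (g x + h x)"
  show "g = \<pi>"
    using * by (intro decomposition_trivial[of g h]) auto
  show "h = \<pi>"
    using * by (intro decomposition_trivial[of h g]) (auto simp: add.commute)
qed

end

section \<open>From the interpolation data to slopes\<close>

lemma affine_on_interval:
  fixes \<pi> :: "real \<Rightarrow> real"
  assumes "\<exists>c d. \<forall>x\<in>{p..q}. \<pi> x = c * x + d" and "\<pi> p = y" "\<pi> q = y + s * (q - p)"
    and x: "p \<le> x" "x \<le> q"
  shows "\<pi> x = y + s * (x - p)"
proof (cases "p = q")
  case False
  obtain c d where cd: "\<And>x. x \<in> {p..q} \<Longrightarrow> \<pi> x = c * x + d" using assms(1) by blast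
  have "c * (q - p) = s * (q - p)"
    using cd[of p] cd[of q] assms(2,3) x by (simp add: algebra_simps)
  then have "c = s" using False by simp
  then show ?thesis using cd[of p] cd[of x] assms(2) x by (simp add: algebra_simps)
qed (use assms in simp)

theorem theorem8p1:
  fixes f a b v :: real and \<pi> :: "real \<Rightarrow> real"
  assumes "0 < f" and "f < 1"
    and "0 \<le> a" and "0 \<le> b" and "b \<le> f"
    and "3 * f + 4 * a - b - 1 \<le> 0"
    and "f^2 + f - 3 * b * f \<noteq> 0"
    and "v = (f^2 + f * a - 3 * f * b - 3 * a * b + b) / (f^2 + f - 3 * b * f)"
    and "consistent_data (breakpoint_data f a b v)"
    and "\<forall>x. \<pi> (x + 1) = \<pi> x"
    and "pwl_interpolant (breakpoint_data f a b v) \<pi>"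
  shows "extreme_function f \<pi>"
proof -
  define C where "C = (1 + f - b) / 2"
  define w where "w = (f - b) / (2 * f)"
  define s1 where "s1 = 1 / f"
  \<comment> \<open>\<open>e\<close> is \<open>2 * (C - b)\<close>, and \<open>s3\<close> is the
    solution of \<open>key\<close>, whose left side is \<open>(f - 3 * b) / (2 * f)\<close>.\<close>
  define e where "e = f + 1 - 3 * b"
  define s3 where "s3 = (f - 3 * b) / (f * e)"
  \<comment> \<open>For \<open>a = 0\<close> the pieces of slope \<open>s2\<close> are degenerate, and any slope up to \<open>s3\<close> will do.\<close>
  define s2 where "s2 = (if a = 0 then s3 else (v - 1) / a)"
  have den: "f^2 + f - 3 * b * f = f * e"
    by (simp add: e_def power2_eq_square algebra_simps)
  have e: "e \<noteq> 0" using assms(7) den by auto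
  \<comment> \<open>The inequalities give \<open>2 * f \<le> 1\<close>; equality would force
    \<open>b = f = 1/2\<close>, hence \<open>e = 0\<close>.\<close>
  have f: "2 * f < 1"
    using assms(3-6) e by (cases "2 * f = 1") (auto simp: e_def)
  have e_pos: "0 < e" using f assms(5) by (simp add: e_def)
  \<comment> \<open>For \<open>a = 0\<close> the breakpoints \<open>f\<close> and
    \<open>f + a\<close> coincide, so their values must agree.\<close>
  have v_one: "v = 1" if "a = 0"
    using assms(9) that by (simp add: consistent_data_def breakpoint_data_def)
  have v: "v * (f * e) = f^2 + f * a - 3 * f * b - 3 * a * b + b"
    using assms(1,8) e den by simp
  have s3: "s3 * (f * e) = f - 3 * b" using assms(1) e by (simp add: s3_def)
  have s1: "s1 * f = 1" using assms(1) by (simp add: s1_def)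
  have w: "2 * w * f = f - b" using assms(1) by (simp add: w_def)
  have w': "2 * w = 1 - s1 * b" using assms(1) by (simp add: w_def s1_def field_simps)
  have C: "2 * C = 1 + f - b" by (simp add: C_def)
  have s2: "1 + s2 * a = v" using v_one by (simp add: s2_def)
  have cancel: "x = y" if "x * (f * e) = y * (f * e)" for x y
    using that assms(1) e by simp
  \<comment> \<open>The given \<open>v\<close> is the height at \<open>f + a\<close> of the line of
    slope \<open>s3\<close> through \<open>(C, w)\<close>; multiplying by \<open>f * e\<close>
    leaves a polynomial identity.\<close>
  have v_fa: "v = w + s3 * (f + a - C)"
  proof (rule cancel)
    have "2 * (w + s3 * (f + a - C)) * (f * e) = (2 * w * f) * e + s3 * (f * e) * (2 * f + 2 * a - 2 * C)"
      by (simp add: algebra_simps)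
    also have "\<dots> = (f - b) * e + (f - 3 * b) * (2 * f + 2 * a - (1 + f - b))"
      by (simp only: w s3 C)
    also have "\<dots> = 2 * (v * (f * e))"
      unfolding v by (simp add: e_def power2_eq_square algebra_simps)
    finally show "v * (f * e) = (w + s3 * (f + a - C)) * (f * e)" by linarith
  qed
  have key: "3 * w - 1 = s3 * (C - b)"
  proof (rule cancel)
    have "2 * ((3 * w - 1) * (f * e)) = 3 * (2 * w * f) * e - 2 * f * e"
      by (simp add: algebra_simps)
    also have "\<dots> = (f - 3 * b) * e"
      by (simp only: w) (simp add: algebra_simps)
    also have "\<dots> = s3 * (f * e) * (2 * C - 2 * b)"
      by (simp only: s3 C) (simp add: e_def)
    finally show "(3 * w - 1) * (f * e) = s3 * (C - b) * (f * e)"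
      by (simp add: algebra_simps)
  qed
  have "(s1 - s3) * (f * e) = (s1 * f) * e - s3 * (f * e)"
    by (simp add: algebra_simps)
  also have "\<dots> = 1"
    by (simp only: s1 s3) (simp add: e_def)
  finally have "0 < (s1 - s3) * (f * e)" by simp
  from zero_less_mult_pos2[OF this] have s31: "s3 \<le> s1"
    using assms(1) e_pos by simp
  have s23: "s2 \<le> s3"
  proof (cases "a = 0")
    case False
    \<comment> \<open>Clearing denominators reduces the order of the slopes to
      \<open>b \<le> f\<close>.\<close>
    have "(s2 - s3) * a * (f * e) = v * (f * e) - f * e - s3 * (f * e) * a"
      by (simp add: s2[symmetric] algebra_simps)
    also have "\<dots> = b - f"
      unfolding v s3 by (simp add: e_def power2_eq_square algebra_simps)
    finally have "(s2 - s3) * (a * (f * e)) \<le> 0"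
      using assms(5) by (simp add: mult.assoc)
    moreover have "0 < a * (f * e)" using False assms(1,3) e_pos by simp
    ultimately show ?thesis using mult_le_cancel_right_pos[of "a * (f * e)" "s2 - s3" 0] by simp
  qed (simp add: s2_def)
  have nodes: "\<pi> 0 = 0" "\<pi> f = 1" "\<pi> (f + a) = v" "\<pi> C = w" "\<pi> (1 + f - C) = 1 - w"
    "\<pi> (1 - a) = 1 - v" "\<pi> 1 = 0"
    using assms(11) by (simp_all add: pwl_interpolant_def breakpoint_data_def C_def w_def field_simps)
  define data where "data = breakpoint_data f a b v"
  have data: "data = [(0, 0), (f, 1), (f + a, v), (C, w), (1 + f - C, 1 - w), (1 - a, 1 - v), (1, 0)]"
    by (simp add: data_def breakpoint_data_def C_def w_def field_simps)
  have affine: "\<exists>c d. \<forall>x\<in>{fst (data ! i)..fst (data ! Suc i)}. \<pi> x = c * x + d" if "Suc i < 7" for i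
    using assms(11) that by (simp add: pwl_interpolant_def data_def breakpoint_data_def)
  note affine = affine[of 0] affine[of 1] affine[of 2] affine[of 3] affine[of 4] affine[of 5]
  interpret three_slope f a b C w s1 s2 s3 \<pi>
  proof
    show "\<pi> x = s1 * x" if "0 \<le> x" "x \<le> f" for x
      using affine_on_interval[of 0 f \<pi> 0 s1 x] affine(1) nodes s1 that
      by (simp add: data)
    show "\<pi> x = 1 + s2 * (x - f)" if "f \<le> x" "x \<le> f + a" for x
      using affine_on_interval[of f "f + a" \<pi> 1 s2 x] affine(2) nodes s2 that
      by (simp add: data)
    show "\<pi> x = w + s3 * (x - C)" if "f + a \<le> x" "x \<le> C" for x
      using affine_on_interval[of "f + a" C \<pi> v s3 x] affine(3) nodes v_fa that
      by (simp add: data algebra_simps)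
    show "\<pi> x = w + s1 * (x - C)" if "C \<le> x" "x \<le> 1 + f - C" for x
      using affine_on_interval[of C "1 + f - C" \<pi> w s1 x] affine(4) nodes w' C that
      by (simp add: data)
    show "\<pi> x = 1 - w + s3 * (x - (1 + f - C))" if "1 + f - C \<le> x" "x \<le> 1 - a" for x
      using affine_on_interval[of "1 + f - C" "1 - a" \<pi> "1 - w" s3 x] affine(5) nodes v_fa that
      by (simp add: data algebra_simps)
    show "\<pi> x = s2 * (x - 1)" if "1 - a \<le> x" "x \<le> 1" for x
      using affine_on_interval[of "1 - a" 1 \<pi> "1 - v" s2 x] affine(6) nodes s2 that
      by (simp add: data algebra_simps)
  qed (use assms(1-6,10) f C s1 w' s2 v_fa key s23 s31 in auto)
  show ?thesis by (rule extreme)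
qed

end
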